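(* Let $\mathbf{I}=[0,1]$ be the unit interval with its natural convex structure, and let $\mathbb{I}$ be the full subcategory of $\mathbf{Cvx}$ whose only object is $\mathbf{I}$. Then $\mathbb{I}$ is dense (left adequate) in $\mathbf{Cvx}$; that is, every convex space $A$ is the canonical colimit $$A\cong\operatorname{colim}\big(\mathbb{I}/A\xrightarrow{\ \pi\ }\mathbb{I}\hookrightarrow\mathbf{Cvx}\big).$$
   Context: A convex space is a (possibly empty) set $A$ together with, for each sequence $\alpha=(\alpha_i)_{i\in\mathbb{N}}$ in $[0,1]$ with only finitely many nonzero terms and $\sum_i\alpha_i=1$, an operation $A^{\mathbb{N}}\to A$, written $(a_i)\mapsto\sum_i\alpha_i a_i$, such that (1) $\sum_i e^j_i a_i=a_j$, where $e^j_i=1$ if $i=j$ and $0$ otherwise; (2) $\sum_i\alpha_i\big(\sum_j\beta^i_j a_j\big)=\sum_j\big(\sum_i\alpha_i\beta^i_j\big)a_j$. Morphisms of the category $\mathbf{Cvx}$ are affine maps, i.e. functions preserving all these operations. The slice category $\mathbb{I}/A$ has as objects the affine maps $n:\mathbf{I}\to A$, and as arrows $n\to m$ the affine maps $\gamma:\mathbf{I}\to\mathbf{I}$ with $m\circ\gamma=n$; $\pi$ is the projection functor sending every object to $\mathbf{I}$ and $\gamma$ to $\gamma$. "Canonical colimit" means that $A$, with the cocone whose component at the object $n$ is $n:\mathbf{I}\to A$ itself, is a colimit of the diagram. *)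

theory Defs
  imports Complex_Main "HOL-Library.FuncSet"
begin

section \<open>Convex spaces and affine maps\<close>

definition weights :: "(nat \<Rightarrow> real) set" where
  "weights = {\<alpha>. (\<forall>i. 0 \<le> \<alpha> i \<and> \<alpha> i \<le> 1) \<and> finite {i. \<alpha> i \<noteq> 0} \<and> (\<Sum>i | \<alpha> i \<noteq> 0. \<alpha> i) = 1}"

text \<open>
  \<open>comb A \<alpha> a\<close> is the combination of the sequence \<open>a\<close> with weights \<open>\<alpha>\<close>; its value matters only
  for \<open>\<alpha> \<in> weights\<close> and sequences \<open>a\<close> in \<open>carrier A\<close>.
\<close>

record 'a cspace =
  carrier :: "'a set"
  comb :: "(nat \<Rightarrow> real) \<Rightarrow> (nat \<Rightarrow> 'a) \<Rightarrow> 'a"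

locale convex_space =
  fixes A :: "'a cspace"
  assumes comb_closed:
      "\<lbrakk>\<alpha> \<in> weights; \<And>i. a i \<in> carrier A\<rbrakk> \<Longrightarrow> comb A \<alpha> a \<in> carrier A"
    and comb_unit:
      "(\<And>i. a i \<in> carrier A) \<Longrightarrow> comb A (\<lambda>i. if i = j then 1 else 0) a = a j"
    and comb_comb:
      "\<lbrakk>\<alpha> \<in> weights; \<And>i. \<beta> i \<in> weights; \<And>i. a i \<in> carrier A\<rbrakk> \<Longrightarrow>
        comb A \<alpha> (\<lambda>i. comb A (\<beta> i) a) = comb A (\<lambda>j. \<Sum>i | \<alpha> i \<noteq> 0. \<alpha> i * \<beta> i j) a"

text \<open>
  Affine maps are taken to be \<open>undefined\<close> outside the carrier, so that equality of functions is
  equality of maps.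
\<close>

definition affine_maps :: "'a cspace \<Rightarrow> 'b cspace \<Rightarrow> ('a \<Rightarrow> 'b) set" where
  "affine_maps A B = {f \<in> carrier A \<rightarrow>\<^sub>E carrier B.
     \<forall>\<alpha> \<in> weights. \<forall>a. (\<forall>i. a i \<in> carrier A) \<longrightarrow>
       f (comb A \<alpha> a) = comb B \<alpha> (\<lambda>i. f (a i))}"

definition unit_interval :: "real cspace" where
  "unit_interval = \<lparr>carrier = {0..1}, comb = (\<lambda>\<alpha> a. \<Sum>i | \<alpha> i \<noteq> 0. \<alpha> i * a i)\<rparr>"

lemma weights_sum_superset:
  assumes "\<alpha> \<in> weights" "finite S" "{i. \<alpha> i \<noteq> 0} \<subseteq> S"
  shows "(\<Sum>i | \<alpha> i \<noteq> 0. \<alpha> i * f i) = (\<Sum>i\<in>S. \<alpha> i * f i)"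
  using assms by (intro sum.mono_neutral_left) auto

lemma convex_space_unit_interval: "convex_space unit_interval"
proof
  fix \<alpha> and a :: "nat \<Rightarrow> real"
  assume \<alpha>: "\<alpha> \<in> weights" and a: "\<And>i. a i \<in> carrier unit_interval"
  have a01: "0 \<le> a i" "a i \<le> 1" for i using a[of i] by (auto simp: unit_interval_def)
  have \<alpha>0: "0 \<le> \<alpha> i" for i using \<alpha> by (auto simp: weights_def)
  have "(\<Sum>i | \<alpha> i \<noteq> 0. \<alpha> i * a i) \<le> (\<Sum>i | \<alpha> i \<noteq> 0. \<alpha> i)"
    using a01 \<alpha>0 by (intro sum_mono) (simp add: mult_left_le)
  also have "\<dots> = 1" using \<alpha> by (simp add: weights_def)
  finally show "comb unit_interval \<alpha> a \<in> carrier unit_interval"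
    using a01 \<alpha>0 by (auto simp: unit_interval_def intro!: sum_nonneg)
next
  fix a :: "nat \<Rightarrow> real" and j
  show "comb unit_interval (\<lambda>i. if i = j then 1 else 0) a = a j"
    by (simp add: unit_interval_def)
next
  fix \<alpha> and \<beta> :: "nat \<Rightarrow> nat \<Rightarrow> real" and a :: "nat \<Rightarrow> real"
  assume \<alpha>: "\<alpha> \<in> weights" and \<beta>: "\<And>i. \<beta> i \<in> weights"
  define I where "I = {i. \<alpha> i \<noteq> 0}"
  define J where "J = (\<Union>i\<in>I. {j. \<beta> i j \<noteq> 0})"
  have fI: "finite I" using \<alpha> by (simp add: I_def weights_def)
  have fJ: "finite J" using fI \<beta> by (auto simp: J_def weights_def)
  have "(\<Sum>i\<in>I. \<alpha> i * (\<Sum>j | \<beta> i j \<noteq> 0. \<beta> i j * a j)) = (\<Sum>i\<in>I. \<alpha> i * (\<Sum>j\<in>J. \<beta> i j * a j))"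
    using fJ by (intro sum.cong refl arg_cong2[of _ _ _ _ "(*)"] weights_sum_superset[OF \<beta>])
      (auto simp: J_def)
  also have "\<dots> = (\<Sum>j\<in>J. (\<Sum>i\<in>I. \<alpha> i * \<beta> i j) * a j)"
    unfolding sum_distrib_left sum_distrib_right
    by (subst sum.swap) (simp add: mult.assoc)
  also have "\<dots> = (\<Sum>j | (\<Sum>i\<in>I. \<alpha> i * \<beta> i j) \<noteq> 0. (\<Sum>i\<in>I. \<alpha> i * \<beta> i j) * a j)"
  proof (intro sum.mono_neutral_right[OF fJ])
    show "{j. (\<Sum>i\<in>I. \<alpha> i * \<beta> i j) \<noteq> 0} \<subseteq> J"
      unfolding J_def by (auto elim!: sum.not_neutral_contains_not_neutral)
  qed auto
  finally show "comb unit_interval \<alpha> (\<lambda>i. comb unit_interval (\<beta> i) a)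
      = comb unit_interval (\<lambda>j. \<Sum>i | \<alpha> i \<noteq> 0. \<alpha> i * \<beta> i j) a"
    by (simp add: unit_interval_def I_def)
qed

lemma affine_id:
  assumes "convex_space A" shows "(\<lambda>x\<in>carrier A. x) \<in> affine_maps A A"
  using convex_space.comb_closed[OF assms] by (auto simp: affine_maps_def)

lemma affine_compose:
  assumes "convex_space A" "f \<in> affine_maps A B" "g \<in> affine_maps B C"
  shows "compose (carrier A) g f \<in> affine_maps A C"
proof -
  have m: "f x \<in> carrier B" if "x \<in> carrier A" for x
    using assms(2) that by (auto simp: affine_maps_def)
  have m': "g x \<in> carrier C" if "x \<in> carrier B" for x
    using assms(3) that by (auto simp: affine_maps_def)
  show ?thesis
    using assms(2,3) m m' convex_space.comb_closed[OF assms(1)]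
    by (auto simp: affine_maps_def compose_def)
qed

lemma affine_compose_id:
  assumes "f \<in> affine_maps A B"
  shows "compose (carrier A) f (\<lambda>x\<in>carrier A. x) = f" "compose (carrier A) (\<lambda>x\<in>carrier B. x) f = f"
  using assms by (auto simp: affine_maps_def compose_def fun_eq_iff PiE_def extensional_def)

lemma affine_mem: "f \<in> affine_maps A B \<Longrightarrow> x \<in> carrier A \<Longrightarrow> f x \<in> carrier B"
  by (auto simp: affine_maps_def)

lemma affine_compose_assoc:
  assumes "f \<in> affine_maps A B"
  shows "compose (carrier A) (compose (carrier B) h g) f = compose (carrier A) h (compose (carrier A) g f)"
  using assms by (auto simp: affine_mem compose_def fun_eq_iff)


section \<open>Categories and functors\<close>

text \<open>
  Hom-sets are indexed by pairs of objects and need not be disjoint. \<open>Comp C x y z g f\<close> is the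
  composite of \<open>f \<in> Hom C x y\<close> followed by \<open>g \<in> Hom C y z\<close>.
\<close>

record ('o, 'm) category =
  Obj :: "'o set"
  Hom :: "'o \<Rightarrow> 'o \<Rightarrow> 'm set"
  Ident :: "'o \<Rightarrow> 'm"
  Comp :: "'o \<Rightarrow> 'o \<Rightarrow> 'o \<Rightarrow> 'm \<Rightarrow> 'm \<Rightarrow> 'm"

locale is_category =
  fixes C :: "('o, 'm) category"
  assumes Ident_in_Hom: "x \<in> Obj C \<Longrightarrow> Ident C x \<in> Hom C x x"
    and Comp_in_Hom:
      "\<lbrakk>x \<in> Obj C; y \<in> Obj C; z \<in> Obj C; f \<in> Hom C x y; g \<in> Hom C y z\<rbrakk> \<Longrightarrow>
        Comp C x y z g f \<in> Hom C x z"
    and Comp_Ident_right: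
      "\<lbrakk>x \<in> Obj C; y \<in> Obj C; f \<in> Hom C x y\<rbrakk> \<Longrightarrow> Comp C x x y f (Ident C x) = f"
    and Comp_Ident_left:
      "\<lbrakk>x \<in> Obj C; y \<in> Obj C; f \<in> Hom C x y\<rbrakk> \<Longrightarrow> Comp C x y y (Ident C y) f = f"
    and Comp_assoc:
      "\<lbrakk>w \<in> Obj C; x \<in> Obj C; y \<in> Obj C; z \<in> Obj C;
        f \<in> Hom C w x; g \<in> Hom C x y; h \<in> Hom C y z\<rbrakk> \<Longrightarrow>
        Comp C w x z (Comp C x y z h g) f = Comp C w y z h (Comp C w x y g f)"

record ('o, 'm, 'p, 'q) functr =
  obj_map :: "'o \<Rightarrow> 'p"
  arr_map :: "'o \<Rightarrow> 'o \<Rightarrow> 'm \<Rightarrow> 'q"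

locale is_functor = C: is_category C + D: is_category D
  for C :: "('o, 'm) category" and D :: "('p, 'q) category" +
  fixes F :: "('o, 'm, 'p, 'q) functr"
  assumes obj_map_in_Obj: "x \<in> Obj C \<Longrightarrow> obj_map F x \<in> Obj D"
    and arr_map_in_Hom:
      "\<lbrakk>x \<in> Obj C; y \<in> Obj C; f \<in> Hom C x y\<rbrakk> \<Longrightarrow>
        arr_map F x y f \<in> Hom D (obj_map F x) (obj_map F y)"
    and arr_map_Ident: "x \<in> Obj C \<Longrightarrow> arr_map F x x (Ident C x) = Ident D (obj_map F x)"
    and arr_map_Comp:
      "\<lbrakk>x \<in> Obj C; y \<in> Obj C; z \<in> Obj C; f \<in> Hom C x y; g \<in> Hom C y z\<rbrakk> \<Longrightarrow>
        arr_map F x z (Comp C x y z g f) =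
          Comp D (obj_map F x) (obj_map F y) (obj_map F z) (arr_map F y z g) (arr_map F x y f)"

definition comp_functr ::
    "('p, 'q, 'r, 's) functr \<Rightarrow> ('o, 'm, 'p, 'q) functr \<Rightarrow> ('o, 'm, 'r, 's) functr" where
  "comp_functr G F =
    \<lparr>obj_map = (\<lambda>x. obj_map G (obj_map F x)),
     arr_map = (\<lambda>x y f. arr_map G (obj_map F x) (obj_map F y) (arr_map F x y f))\<rparr>"

definition full_subcategory :: "('o, 'm) category \<Rightarrow> 'o set \<Rightarrow> ('o, 'm) category" where
  "full_subcategory C S = C\<lparr>Obj := Obj C \<inter> S\<rparr>"

definition inclusion_functr :: "('o, 'm, 'o, 'm) functr" where
  "inclusion_functr = \<lparr>obj_map = (\<lambda>x. x), arr_map = (\<lambda>x y f. f)\<rparr>"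

lemma is_category_full_subcategory:
  assumes "is_category C" shows "is_category (full_subcategory C S)"
proof -
  interpret is_category C by fact
  show ?thesis by unfold_locales (auto simp: full_subcategory_def Ident_in_Hom Comp_in_Hom
    Comp_Ident_right Comp_Ident_left Comp_assoc)
qed

lemma is_functor_inclusion:
  assumes "is_category C" shows "is_functor (full_subcategory C S) C inclusion_functr"
proof -
  interpret is_category C by fact
  interpret S: is_category "full_subcategory C S" using is_category_full_subcategory[OF assms] .
  show ?thesis by unfold_locales (auto simp: full_subcategory_def inclusion_functr_def)
qed

lemma is_functor_comp:
  assumes "is_functor C D F" "is_functor D E G" shows "is_functor C E (comp_functr G F)"
proof -
  interpret F: is_functor C D F by fact
  interpret G: is_functor D E G by fact
  show ?thesis by unfold_locales (auto simp: comp_functr_def F.obj_map_in_Obj F.arr_map_in_Hom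
    F.arr_map_Ident F.arr_map_Comp G.obj_map_in_Obj G.arr_map_in_Hom
    G.arr_map_Ident G.arr_map_Comp)
qed


section \<open>The category of convex spaces\<close>

definition Cvx :: "('a cspace, 'a \<Rightarrow> 'a) category" where
  "Cvx =
    \<lparr>Obj = {A. convex_space A},
     Hom = affine_maps,
     Ident = (\<lambda>A. \<lambda>x \<in> carrier A. x),
     Comp = (\<lambda>A B C g f. compose (carrier A) g f)\<rparr>"

definition interval_category :: "(real cspace, real \<Rightarrow> real) category" where
  "interval_category = full_subcategory Cvx {unit_interval}"

definition interval_slice :: "'a cspace \<Rightarrow> (real \<Rightarrow> 'a, real \<Rightarrow> real) category" where
  "interval_slice A =
    \<lparr>Obj = affine_maps unit_interval A,
     Hom = (\<lambda>n m. {\<gamma> \<in> Hom interval_category unit_interval unit_interval.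
                     compose (carrier unit_interval) m \<gamma> = n}),
     Ident = (\<lambda>n. Ident interval_category unit_interval),
     Comp = (\<lambda>n m k. Comp interval_category unit_interval unit_interval unit_interval)\<rparr>"

definition slice_projection :: "(real \<Rightarrow> 'a, real \<Rightarrow> real, real cspace, real \<Rightarrow> real) functr" where
  "slice_projection = \<lparr>obj_map = (\<lambda>n. unit_interval), arr_map = (\<lambda>n m \<gamma>. \<gamma>)\<rparr>"

lemma is_category_Cvx: "is_category Cvx"
  by unfold_locales (auto simp: Cvx_def affine_id affine_compose affine_compose_id affine_compose_assoc)

lemmas interval_category_defs = interval_category_def full_subcategory_def Cvx_def

lemma is_category_interval_slice:
  "is_category (interval_slice A)"
proof
qed (auto simp: interval_slice_def interval_category_defs convex_space_unit_interval affine_id affine_compose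
   affine_compose_id affine_compose_assoc[symmetric] intro: affine_compose_assoc)

lemma is_functor_slice_projection:
  "is_functor (interval_slice A) interval_category slice_projection"
proof -
  interpret is_category "interval_slice A" using is_category_interval_slice .
  interpret I: is_category interval_category
    unfolding interval_category_def using is_category_full_subcategory[OF is_category_Cvx] .
  show ?thesis
    by unfold_locales (auto simp: interval_slice_def interval_category_defs slice_projection_def convex_space_unit_interval)
qed


section \<open>Colimits of diagrams of convex spaces\<close>

text \<open>
  The carrier types of the spaces in the diagram (\<open>'c\<close>), of the colimit (\<open>'a\<close>) and of the
  spaces against which the universal property is tested (\<open>'b\<close>) may all differ. The last of these
  occurs only under a quantifier, so it is passed as a type argument; a statement that is
  polymorphic in \<open>'b\<close> covers test spaces over every type.
\<close>

definition is_cocone ::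
    "('j, 'k) category \<Rightarrow> ('j, 'k, 'c cspace, 'c \<Rightarrow> 'c) functr \<Rightarrow> 'b cspace \<Rightarrow>
      ('j \<Rightarrow> 'c \<Rightarrow> 'b) \<Rightarrow> bool" where
  "is_cocone J D B \<mu> \<longleftrightarrow>
    convex_space B \<and>
    (\<forall>j \<in> Obj J. \<mu> j \<in> affine_maps (obj_map D j) B) \<and>
    (\<forall>i \<in> Obj J. \<forall>j \<in> Obj J. \<forall>u \<in> Hom J i j.
       compose (carrier (obj_map D i)) (\<mu> j) (arr_map D i j u) = \<mu> i)"

definition is_colimit ::
    "'b itself \<Rightarrow> ('j, 'k) category \<Rightarrow> ('j, 'k, 'c cspace, 'c \<Rightarrow> 'c) functr \<Rightarrow> 'a cspace \<Rightarrow>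
      ('j \<Rightarrow> 'c \<Rightarrow> 'a) \<Rightarrow> bool" where
  "is_colimit (_ :: 'b itself) J D A \<kappa> \<longleftrightarrow>
    is_functor J Cvx D \<and>
    is_cocone J D A \<kappa> \<and>
    (\<forall>(B :: 'b cspace) \<mu>. is_cocone J D B \<mu> \<longrightarrow>
       (\<exists>!h. h \<in> affine_maps A B \<and>
         (\<forall>j \<in> Obj J. compose (carrier (obj_map D j)) h (\<kappa> j) = \<mu> j)))"

end

theory Submission
  imports Defs
begin

text \<open>
  A cocone \<open>\<mu>\<close> assigns to every affine path \<open>n\<close> in \<open>A\<close> an affine path \<open>\<mu> n\<close> in \<open>B\<close>, compatibly
  with reparametrisation. Every point \<open>n t\<close> of a path gives a constant path, which is \<open>n\<close> precomposed
  with the constant map at \<open>t\<close>; compatibility therefore makes \<open>\<mu>\<close> of that constant path the constant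
  path at \<open>\<mu> n t\<close>. So a factorisation \<open>h\<close> has only one possible value at \<open>a\<close>, namely the value
  taken by \<open>\<mu>\<close> of the constant path at \<open>a\<close>, and this choice satisfies \<open>h (n t) = \<mu> n t\<close>
  (\<open>cocone_value_at_point\<close>).

  What remains is that this \<open>h\<close> is affine. Any two points of \<open>A\<close> are joined by the affine path of
  their binary combinations (\<open>segment_affine\<close>). Along that path \<open>h\<close> agrees with an affine map
  into \<open>B\<close>, so \<open>h\<close> preserves binary combinations. Since a finite combination can be built by
  iterated binary ones (\<open>comb_split\<close>), \<open>h\<close> preserves all combinations
  (\<open>comb_preserved_if_binary\<close>).
\<close>

section \<open>Weights\<close>

lemma weightsI:
  assumes "finite S" "\<And>i. 0 \<le> \<alpha> i" "\<And>i. i \<notin> S \<Longrightarrow> \<alpha> i = 0" "sum \<alpha> S = 1"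
  shows "\<alpha> \<in> weights"
proof -
  have sub: "{i. \<alpha> i \<noteq> 0} \<subseteq> S"
    using assms(3) by auto
  have "sum \<alpha> {i. \<alpha> i \<noteq> 0} = sum \<alpha> S"
    using assms(1) sub by (intro sum.mono_neutral_left) auto
  moreover have "\<alpha> i \<le> 1" for i
  proof (cases "i \<in> S")
    case True
    then show ?thesis
      using member_le_sum[of i S \<alpha>] assms by auto
  qed (simp add: assms)
  ultimately show ?thesis
    using assms finite_subset[OF sub] by (auto simp: weights_def)
qed

lemma unit_weight: "(\<lambda>i. if i = j then 1 else 0) \<in> weights"
  by (rule weightsI[of "{j}"]) auto

definition binary_weight :: "real \<Rightarrow> nat \<Rightarrow> real" where
  "binary_weight t = (\<lambda>i. if i = 0 then 1 - t else if i = 1 then t else 0)"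

lemma binary_weight: "t \<in> {0..1} \<Longrightarrow> binary_weight t \<in> weights"
  by (rule weightsI[of "{0, 1}"]) (auto simp: binary_weight_def)

lemma sum_binary_weight:
  "(\<Sum>i | binary_weight t i \<noteq> 0. binary_weight t i * f i) = (1 - t) * f 0 + t * f 1"
proof -
  have "(\<Sum>i | binary_weight t i \<noteq> 0. binary_weight t i * f i) = (\<Sum>i\<in>{0, 1}. binary_weight t i * f i)"
    by (intro sum.mono_neutral_left) (auto simp: binary_weight_def split: if_splits)
  then show ?thesis
    by (simp add: binary_weight_def)
qed

definition remaining_weight :: "(nat \<Rightarrow> real) \<Rightarrow> nat \<Rightarrow> nat \<Rightarrow> real" where
  "remaining_weight \<alpha> j = (\<lambda>i. if i = j then 0 else \<alpha> i / (1 - \<alpha> j))"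

lemma remaining_weight:
  assumes "\<alpha> \<in> weights" "\<alpha> j < 1"
  shows "remaining_weight \<alpha> j \<in> weights"
proof (rule weightsI[of "{i. \<alpha> i \<noteq> 0} - {j}"])
  have fin: "finite {i. \<alpha> i \<noteq> 0}" and sum1: "sum \<alpha> {i. \<alpha> i \<noteq> 0} = 1"
    using assms by (auto simp: weights_def)
  have "sum \<alpha> ({i. \<alpha> i \<noteq> 0} - {j}) = 1 - \<alpha> j"
    using fin sum1 by (cases "\<alpha> j = 0") (auto simp: sum_diff1)
  moreover have "sum (remaining_weight \<alpha> j) ({i. \<alpha> i \<noteq> 0} - {j})
      = (\<Sum>i\<in>{i. \<alpha> i \<noteq> 0} - {j}. \<alpha> i / (1 - \<alpha> j))"
    by (intro sum.cong) (auto simp: remaining_weight_def)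
  ultimately show "sum (remaining_weight \<alpha> j) ({i. \<alpha> i \<noteq> 0} - {j}) = 1"
    using assms by (simp add: sum_divide_distrib[symmetric])
qed (use assms in \<open>auto simp: remaining_weight_def weights_def\<close>)

lemma weights_eq_unit:
  assumes "\<alpha> \<in> weights" "\<alpha> j = 1"
  shows "\<alpha> = (\<lambda>i. if i = j then 1 else 0)"
proof
  fix i
  have fin: "finite {i. \<alpha> i \<noteq> 0}" and sum1: "sum \<alpha> {i. \<alpha> i \<noteq> 0} = 1" and nonneg: "\<And>i. 0 \<le> \<alpha> i"
    using assms by (auto simp: weights_def)
  have "sum \<alpha> ({i. \<alpha> i \<noteq> 0} - {j}) = 0"
    using fin sum1 assms by (simp add: sum_diff1)
  then show "\<alpha> i = (if i = j then 1 else 0)"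
    using fin nonneg assms(2) by (auto simp: sum_nonneg_eq_0_iff)
qed


section \<open>Combinations as iterated binary combinations\<close>

lemma comb_const:
  assumes "convex_space A" "\<alpha> \<in> weights" "x \<in> carrier A"
  shows "comb A \<alpha> (\<lambda>i. x) = x"
proof -
  interpret convex_space A by fact
  let ?e = "\<lambda>i::nat. if i = 0 then 1 else 0 :: real"
  have e: "comb A ?e (\<lambda>i. x) = x"
    using comb_unit[of "\<lambda>i. x" 0] assms by simp
  have "(\<lambda>j. \<Sum>i | \<alpha> i \<noteq> 0. \<alpha> i * ?e j) = ?e"
    using assms(2) by (auto simp: weights_def fun_eq_iff sum_distrib_right[symmetric])
  then show ?thesis
    using comb_comb[of \<alpha> "\<lambda>_. ?e" "\<lambda>i. x"] e assms unit_weight[of 0] by simp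
qed

lemma comb_split:
  assumes "convex_space A" "\<alpha> \<in> weights" "\<alpha> j < 1" "\<And>i. a i \<in> carrier A"
  shows "comb A \<alpha> a =
    comb A (binary_weight (1 - \<alpha> j)) (\<lambda>i. if i = 0 then a j else comb A (remaining_weight \<alpha> j) a)"
proof -
  interpret convex_space A by fact
  define \<beta> where
    "\<beta> i = (if i = 0 then (\<lambda>k. if k = j then 1 else 0) else remaining_weight \<alpha> j)" for i :: nat
  have t: "1 - \<alpha> j \<in> {0..1}"
    using assms(2) by (auto simp: weights_def)
  have \<beta>: "\<beta> i \<in> weights" for i
    using remaining_weight[OF assms(2,3)] unit_weight[of j] by (simp add: \<beta>_def)
  have 1: "(\<lambda>i. comb A (\<beta> i) a) = (\<lambda>i. if i = 0 then a j else comb A (remaining_weight \<alpha> j) a)"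
    using comb_unit[of a j] assms(4) by (auto simp: \<beta>_def)
  have 2: "(\<lambda>k. \<Sum>i | binary_weight (1 - \<alpha> j) i \<noteq> 0. binary_weight (1 - \<alpha> j) i * \<beta> i k) = \<alpha>"
    using assms(3) by (auto simp: sum_binary_weight \<beta>_def remaining_weight_def fun_eq_iff)
  show ?thesis
    using comb_comb[of "binary_weight (1 - \<alpha> j)" \<beta> a, OF binary_weight[OF t] \<beta> assms(4)]
    by (simp only: 1 2)
qed

text \<open>
  Splitting off one index \<open>j\<close> of the support leaves the remaining weights, rescaled, on a smaller
  support; the induction is on the size of the support.
\<close>

lemma comb_preserved_if_binary:
  assumes A: "convex_space A" and B: "convex_space B"
    and h: "\<And>x. x \<in> carrier A \<Longrightarrow> h x \<in> carrier B"
    and binary: "\<And>t x y. \<lbrakk>t \<in> {0..1}; x \<in> carrier A; y \<in> carrier A\<rbrakk> \<Longrightarrow>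
      h (comb A (binary_weight t) (\<lambda>i. if i = 0 then x else y)) =
        comb B (binary_weight t) (\<lambda>i. if i = 0 then h x else h y)"
    and \<alpha>: "\<alpha> \<in> weights" and a: "\<And>i. a i \<in> carrier A"
  shows "h (comb A \<alpha> a) = comb B \<alpha> (\<lambda>i. h (a i))"
  using \<alpha>
proof (induction "card {i. \<alpha> i \<noteq> 0}" arbitrary: \<alpha> rule: less_induct)
  case less
  interpret A: convex_space A by fact
  interpret B: convex_space B by fact
  have fin: "finite {i. \<alpha> i \<noteq> 0}" and "sum \<alpha> {i. \<alpha> i \<noteq> 0} = 1"
    using less.prems by (auto simp: weights_def)
  then have "{i. \<alpha> i \<noteq> 0} \<noteq> {}"
    by (metis sum.empty zero_neq_one)
  then obtain j where j: "\<alpha> j \<noteq> 0"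
    by blast
  show ?case
  proof (cases "\<alpha> j = 1")
    case True
    show ?thesis
      using A.comb_unit[of a j] B.comb_unit[of "\<lambda>i. h (a i)" j] a h
      by (simp add: weights_eq_unit[OF less.prems True])
  next
    case False
    then have lt: "\<alpha> j < 1" and t: "1 - \<alpha> j \<in> {0..1}"
      using less.prems by (auto simp: weights_def order.strict_iff_order)
    let ?\<rho> = "remaining_weight \<alpha> j"
    have \<rho>: "?\<rho> \<in> weights"
      using remaining_weight[OF less.prems lt] .
    have "{i. ?\<rho> i \<noteq> 0} \<subset> {i. \<alpha> i \<noteq> 0}"
      using j by (auto simp: remaining_weight_def)
    then have IH: "h (comb A ?\<rho> a) = comb B ?\<rho> (\<lambda>i. h (a i))"
      using less.hyps \<rho> psubset_card_mono[OF fin] by blast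
    show ?thesis
      using binary[OF t a[of j] A.comb_closed[OF \<rho> a]] IH a h
      by (simp add: comb_split[OF A less.prems lt] comb_split[OF B less.prems lt] cong: if_cong)
  qed
qed


section \<open>Constant paths and segments\<close>

lemma carrier_unit_interval [simp]: "carrier unit_interval = {0..1}"
  by (simp add: unit_interval_def)

lemma const_affine:
  assumes "convex_space A" "convex_space B" "x \<in> carrier B"
  shows "(\<lambda>t\<in>carrier A. x) \<in> affine_maps A B"
  using assms convex_space.comb_closed[OF assms(1)] comb_const[OF assms(2)]
  by (auto simp: affine_maps_def)

definition segment :: "'a cspace \<Rightarrow> 'a \<Rightarrow> 'a \<Rightarrow> real \<Rightarrow> 'a" where
  "segment A x y = (\<lambda>t\<in>{0..1}. comb A (binary_weight t) (\<lambda>i. if i = 0 then x else y))"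

text \<open>
  The weights \<open>binary_weight t\<close> depend affinely on \<open>t\<close>, so this is an instance of the
  associativity law \<open>comb_comb\<close>.
\<close>

lemma segment_affine:
  assumes "convex_space A" "x \<in> carrier A" "y \<in> carrier A"
  shows "segment A x y \<in> affine_maps unit_interval A"
proof -
  interpret convex_space A by fact
  let ?s = "\<lambda>i::nat. if i = 0 then x else y"
  have s: "?s i \<in> carrier A" for i
    using assms by simp
  have "segment A x y (comb unit_interval \<alpha> t) = comb A \<alpha> (\<lambda>i. segment A x y (t i))"
    if \<alpha>: "\<alpha> \<in> weights" and t: "\<forall>i. t i \<in> carrier unit_interval" for \<alpha> t
  proof -
    have sum1: "sum \<alpha> {i. \<alpha> i \<noteq> 0} = 1"
      using \<alpha> by (simp add: weights_def)
    let ?m = "\<Sum>i | \<alpha> i \<noteq> 0. \<alpha> i * t i"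
    have m: "?m \<in> {0..1}"
      using convex_space.comb_closed[OF convex_space_unit_interval \<alpha>, of t] t
      by (simp add: unit_interval_def)
    have bw: "(\<lambda>j. \<Sum>i | \<alpha> i \<noteq> 0. \<alpha> i * binary_weight (t i) j) = binary_weight ?m"
      using sum1 by (auto simp: binary_weight_def fun_eq_iff algebra_simps sum_subtractf)
    have "comb A \<alpha> (\<lambda>i. comb A (binary_weight (t i)) ?s) = comb A (binary_weight ?m) ?s"
      using comb_comb[of \<alpha> "\<lambda>i. binary_weight (t i)" ?s] \<alpha> t s binary_weight
      by (simp only: bw carrier_unit_interval)
    moreover have "segment A x y (t i) = comb A (binary_weight (t i)) ?s" for i
      using t by (simp add: segment_def)
    moreover have "comb unit_interval \<alpha> t = ?m"
      by (simp add: unit_interval_def)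
    ultimately show ?thesis
      using m by (simp add: segment_def)
  qed
  moreover have "segment A x y \<in> {0..1} \<rightarrow>\<^sub>E carrier A"
    using s binary_weight comb_closed by (auto simp: segment_def)
  ultimately show ?thesis
    by (auto simp: affine_maps_def)
qed

lemma segment_ends:
  assumes "convex_space A" "x \<in> carrier A" "y \<in> carrier A"
  shows "segment A x y 0 = x" "segment A x y 1 = y"
proof -
  interpret convex_space A by fact
  let ?s = "\<lambda>i::nat. if i = 0 then x else y"
  have "binary_weight 0 = (\<lambda>i. if i = 0 then 1 else 0)"
    "binary_weight 1 = (\<lambda>i. if i = 1 then 1 else 0)"
    by (auto simp: binary_weight_def)
  then show "segment A x y 0 = x" "segment A x y 1 = y"
    using comb_unit[of ?s 0] comb_unit[of ?s 1] assms by (auto simp: segment_def)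
qed

lemma affine_path_eq_comb:
  assumes "f \<in> affine_maps unit_interval B" "t \<in> {0..1}"
  shows "f t = comb B (binary_weight t) (\<lambda>i. if i = 0 then f 0 else f 1)"
proof -
  let ?e = "\<lambda>i::nat. if i = 0 then 0 else 1 :: real"
  have "comb unit_interval (binary_weight t) ?e = t"
    by (simp add: unit_interval_def sum_binary_weight)
  moreover have "f (comb unit_interval (binary_weight t) ?e) = comb B (binary_weight t) (\<lambda>i. f (?e i))"
    using assms binary_weight by (simp add: affine_maps_def)
  ultimately show ?thesis
    by (simp add: if_distrib[of f])
qed


section \<open>Cocones over the slice of the interval\<close>

abbreviation interval_diagram ::
    "(real \<Rightarrow> 'a, real \<Rightarrow> real, real cspace, real \<Rightarrow> real) functr" where
  "interval_diagram \<equiv> comp_functr inclusion_functr slice_projection"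

lemma interval_diagram_simps [simp]:
  "obj_map interval_diagram n = unit_interval"
  "arr_map interval_diagram n m \<gamma> = \<gamma>"
  by (simp_all add: comp_functr_def inclusion_functr_def slice_projection_def)

lemma interval_slice_simps [simp]:
  "Obj (interval_slice A) = affine_maps unit_interval A"
  "Hom (interval_slice A) n m =
    {\<gamma> \<in> affine_maps unit_interval unit_interval. compose {0..1} m \<gamma> = n}"
  by (simp_all add: interval_slice_def interval_category_defs)

lemma is_functor_interval_diagram: "is_functor (interval_slice A) Cvx interval_diagram"
proof (rule is_functor_comp)
  show "is_functor (interval_slice A) interval_category slice_projection"
    by (rule is_functor_slice_projection)
  show "is_functor interval_category Cvx inclusion_functr"
    unfolding interval_category_def by (rule is_functor_inclusion[OF is_category_Cvx])
qed

text \<open>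
  The constant map at \<open>t\<close> is an arrow of the slice from the constant path at \<open>n t\<close> to \<open>n\<close>, and
  the cocone condition at this arrow is the equation.
\<close>

lemma cocone_value_at_point:
  assumes "is_cocone (interval_slice A) interval_diagram B \<mu>" "convex_space A"
    and n: "n \<in> affine_maps unit_interval A" and t: "t \<in> {0..1}" and s: "s \<in> {0..1}"
  shows "\<mu> (\<lambda>_\<in>{0..1}. n t) s = \<mu> n t"
proof -
  let ?\<gamma> = "\<lambda>_\<in>{0..1}. t"
  have \<gamma>: "?\<gamma> \<in> affine_maps unit_interval unit_interval"
    using const_affine[OF convex_space_unit_interval convex_space_unit_interval, of t] t by simp
  have "n t \<in> carrier A"
    using affine_mem[OF n] t by simp
  then have c: "(\<lambda>_\<in>{0..1}. n t) \<in> affine_maps unit_interval A"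
    using const_affine[OF convex_space_unit_interval assms(2), of "n t"] by simp
  have "compose {0..1} n ?\<gamma> = (\<lambda>_\<in>{0..1}. n t)"
    by (auto simp: compose_def fun_eq_iff)
  then have "compose {0..1} (\<mu> n) ?\<gamma> = \<mu> (\<lambda>_\<in>{0..1}. n t)"
    using assms(1) n c \<gamma> unfolding is_cocone_def by auto
  then show ?thesis
    using s by (metis (no_types, lifting) compose_eq restrict_apply')
qed

theorem mainTheorem6:
  fixes A :: "'a cspace"
  assumes "convex_space A"
  shows "is_colimit TYPE('b) (interval_slice A) (comp_functr inclusion_functr slice_projection) A
    (\<lambda>n. n)"
proof -
  have "is_cocone (interval_slice A) interval_diagram A (\<lambda>n. n)"
    using assms by (simp add: is_cocone_def)
  moreover have "\<exists>!h. h \<in> affine_maps A B \<and>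
      (\<forall>n \<in> affine_maps unit_interval A. compose {0..1} h n = \<mu> n)"
    if cocone: "is_cocone (interval_slice A) interval_diagram B \<mu>" for B :: "'b cspace" and \<mu>
  proof -
    have B: "convex_space B" and \<mu>: "\<And>n. n \<in> affine_maps unit_interval A \<Longrightarrow> \<mu> n \<in> affine_maps unit_interval B"
      using cocone by (simp_all add: is_cocone_def)
    have const: "(\<lambda>_\<in>{0..1}. x) \<in> affine_maps unit_interval A" if "x \<in> carrier A" for x
      using const_affine[OF convex_space_unit_interval assms that] by simp
    define h where "h = (\<lambda>x\<in>carrier A. \<mu> (\<lambda>_\<in>{0..1}. x) 0)"
    have h_path: "h (n t) = \<mu> n t" if "n \<in> affine_maps unit_interval A" "t \<in> {0..1}" for n t
      using cocone_value_at_point[OF cocone assms that, of 0] affine_mem[OF that(1)] that(2)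
      by (simp add: h_def)
    have h_mem: "h x \<in> carrier B" if "x \<in> carrier A" for x
      using affine_mem[OF \<mu>[OF const[OF that]], of 0] that by (simp add: h_def)
    have h_binary: "h (comb A (binary_weight t) (\<lambda>i. if i = 0 then x else y)) =
        comb B (binary_weight t) (\<lambda>i. if i = 0 then h x else h y)"
      if t: "t \<in> {0..1}" and x: "x \<in> carrier A" and y: "y \<in> carrier A" for t x y
    proof -
      note seg = segment_affine[OF assms x y]
      have "h (comb A (binary_weight t) (\<lambda>i. if i = 0 then x else y)) = h (segment A x y t)"
        using t by (simp add: segment_def)
      also have "\<dots> = \<mu> (segment A x y) t"
        using h_path[OF seg t] .
      also have "\<dots> = comb B (binary_weight t)
          (\<lambda>i. if i = 0 then \<mu> (segment A x y) 0 else \<mu> (segment A x y) 1)"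
        using affine_path_eq_comb[OF \<mu>[OF seg] t] .
      also have "\<dots> = comb B (binary_weight t) (\<lambda>i. if i = 0 then h x else h y)"
        using h_path[OF seg, of 0] h_path[OF seg, of 1] by (simp add: segment_ends[OF assms x y] cong: if_cong)
      finally show ?thesis .
    qed
    have "h (comb A \<alpha> a) = comb B \<alpha> (\<lambda>i. h (a i))"
      if "\<alpha> \<in> weights" "\<forall>i. a i \<in> carrier A" for \<alpha> a
      by (rule comb_preserved_if_binary[OF assms B h_mem h_binary]) (use that in auto)
    moreover have "h \<in> carrier A \<rightarrow>\<^sub>E carrier B"
      using h_mem by (auto simp: h_def)
    ultimately have h_affine: "h \<in> affine_maps A B"
      by (auto simp: affine_maps_def)
    have h_factor: "compose {0..1} h n = \<mu> n" if n: "n \<in> affine_maps unit_interval A" for n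
      using h_path[OF n] \<mu>[OF n]
      by (auto simp: affine_maps_def compose_def fun_eq_iff PiE_def extensional_def)
    show ?thesis
    proof (rule ex1I[of _ h])
      fix k
      assume k: "k \<in> affine_maps A B \<and>
        (\<forall>n \<in> affine_maps unit_interval A. compose {0..1} k n = \<mu> n)"
      show "k = h"
      proof (rule extensionalityI[of _ "carrier A"])
        fix x
        assume x: "x \<in> carrier A"
        have "k x = compose {0..1} k (\<lambda>_\<in>{0..1}. x) (0::real)"
          by (simp add: compose_def)
        also have "\<dots> = h x"
          using k const[OF x] x by (simp add: h_def)
        finally show "k x = h x" .
      qed (use k in \<open>auto simp: h_def affine_maps_def PiE_def\<close>)
    qed (use h_affine h_factor in blast)
  qed
  ultimately show ?thesis
    using is_functor_interval_diagram by (simp add: is_colimit_def)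
qed

end
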